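(* Let $E\subset\mathbb{N}^p\setminus\{0\}$ be a (finite) incomparable set. The following are equivalent: (a) $\langle E\rangle$ is a $\mathcal{C}$-semigroup. (b) The set of affine semigroups with set of multiplicities $E$ is finite. (c) The set of strong affine semigroups with set of multiplicities $E$ is finite.
   Context: Here $p\ge 1$ and $\mathbb{N}$ is the set of non-negative integers. An affine semigroup $S\subseteq\mathbb{N}^p$ is a finitely generated submonoid of $\mathbb{N}^p$; $\langle L\rangle$ denotes the submonoid generated by a finite set $L$; $\operatorname{msg}(S)$ is the unique minimal generating set of $S$. For a finite set $L=\{l_1,\dots,l_k\}\subseteq\mathbb{N}^p$, $\mathcal{C}(L)=\{\sum_i\alpha_i l_i\mid\alpha_i\in\mathbb{R}_{\ge 0}\}\cap\mathbb{N}^p$, and $\mathcal{C}(S)=\mathcal{C}(\operatorname{msg}(S))$. For an affine semigroup $T$ (such as $\mathcal{C}(S)$), $x\le_T y$ means $y-x\in T$. The set of multiplicities of $S$ is $\operatorname{Mult}(S)=\min_{\le_{\mathcal{C}(S)}}(S\setminus\{0\})$, the set of minimal elements of $S\setminus\{0\}$ for $\le_{\mathcal{C}(S)}$. A finite set $E\subset\mathbb{N}^p\setminus\{0\}$ is incomparable if $E=\min_{\le_{\mathcal{C}(E)}}(E)$, i.e. its elements are pairwise incomparable for $\le_{\mathcal{C}(E)}$. An affine semigroup $S$ is strong if for all $x,y\in S\setminus\{0\}$ with $x\ne y$ there exists $e\in\operatorname{Mult}(S)$ such that $x+y-e\in S$. An affine semigroup $S$ is a $\mathcal{C}$-semigroup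 if $\mathcal{C}(S)\setminus S$ is finite. *)

theory Defs
  imports "HOL-Analysis.Analysis"
begin

definition submonoid_vec :: "(nat ^ 'p) set \<Rightarrow> bool" where
  "submonoid_vec S \<longleftrightarrow> 0 \<in> S \<and> (\<forall>x\<in>S. \<forall>y\<in>S. x + y \<in> S)"

definition generated :: "(nat ^ 'p) set \<Rightarrow> (nat ^ 'p) set" where
  "generated L = submonoid_vec hull L"

definition affine_semigroup :: "(nat ^ 'p) set \<Rightarrow> bool" where
  "affine_semigroup S \<longleftrightarrow> (\<exists>L. finite L \<and> S = generated L)"

definition minimal_generating_set :: "(nat ^ 'p) set \<Rightarrow> (nat ^ 'p) set \<Rightarrow> bool" where
  "minimal_generating_set S A \<longleftrightarrow> generated A = S \<and> (\<forall>B. B \<subset> A \<longrightarrow> generated B \<noteq> S)"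

(* Well-defined on submonoids by lemma minimal_generating_set_ex1 below. *)
definition msg :: "(nat ^ 'p) set \<Rightarrow> (nat ^ 'p) set" where
  "msg S = (THE A. minimal_generating_set S A)"

definition real_vec :: "nat ^ 'p \<Rightarrow> real ^ 'p" where
  "real_vec x = (\<chi> i. real (x $ i))"

(* Meant for finite L only: the sum is 0 when L is infinite. *)
definition int_cone :: "(nat ^ 'p) set \<Rightarrow> (nat ^ 'p) set" where
  "int_cone L = {x. \<exists>\<alpha>. (\<forall>l\<in>L. 0 \<le> \<alpha> l) \<and> real_vec x = (\<Sum>l\<in>L. \<alpha> l *\<^sub>R real_vec l)}"

definition cone_of :: "(nat ^ 'p) set \<Rightarrow> (nat ^ 'p) set" where
  "cone_of S = int_cone (msg S)"

(* y - x lies in T, stated additively because subtraction on nat truncates. *)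
definition le_sg :: "(nat ^ 'p) set \<Rightarrow> nat ^ 'p \<Rightarrow> nat ^ 'p \<Rightarrow> bool" where
  "le_sg T x y \<longleftrightarrow> (\<exists>t\<in>T. y = x + t)"

definition min_sg :: "(nat ^ 'p) set \<Rightarrow> (nat ^ 'p) set \<Rightarrow> (nat ^ 'p) set" where
  "min_sg T A = {x \<in> A. \<forall>y\<in>A. le_sg T y x \<longrightarrow> y = x}"

definition Mult :: "(nat ^ 'p) set \<Rightarrow> (nat ^ 'p) set" where
  "Mult S = min_sg (cone_of S) (S - {0})"

definition incomparable :: "(nat ^ 'p) set \<Rightarrow> bool" where
  "incomparable E \<longleftrightarrow> finite E \<and> 0 \<notin> E \<and> E = min_sg (int_cone E) E"

(* The inner existential says x + y - e \<in> S, with the difference taken over the integers. *)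
definition strong :: "(nat ^ 'p) set \<Rightarrow> bool" where
  "strong S \<longleftrightarrow> affine_semigroup S \<and>
     (\<forall>x \<in> S - {0}. \<forall>y \<in> S - {0}. x \<noteq> y \<longrightarrow> (\<exists>e \<in> Mult S. \<exists>s\<in>S. x + y = e + s))"

definition C_semigroup :: "(nat ^ 'p) set \<Rightarrow> bool" where
  "C_semigroup S \<longleftrightarrow> affine_semigroup S \<and> finite (cone_of S - S)"

lemma submonoid_generated: "submonoid_vec (generated L)"
  unfolding generated_def by (rule hull_in) (auto simp: submonoid_vec_def)

lemma subset_generated: "L \<subseteq> generated L"
  unfolding generated_def by (rule hull_subset)

lemma generated_minimal: "L \<subseteq> S \<Longrightarrow> submonoid_vec S \<Longrightarrow> generated L \<subseteq> S"
  unfolding generated_def by (rule hull_minimal)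

lemma minimal_generating_set_ex1:
  fixes S :: "(nat ^ 'p) set"
  assumes S: "submonoid_vec S"
  shows "\<exists>!A. minimal_generating_set S A"
proof -
  define I where "I = {x \<in> S - {0}. \<forall>a \<in> S - {0}. \<forall>b \<in> S - {0}. x \<noteq> a + b}"
  have I_sub: "I \<subseteq> A" if A: "generated A = S" for A
  proof
    fix x assume x: "x \<in> I"
    show "x \<in> A"
    proof (rule ccontr)
      assume "x \<notin> A"
      then have "A \<subseteq> S - {x}" using subset_generated[of A] A by auto
      moreover have "submonoid_vec (S - {x})"
        unfolding submonoid_vec_def
      proof (intro conjI ballI)
        show "0 \<in> S - {x}" using S x by (auto simp: submonoid_vec_def I_def)
        fix a b assume ab: "a \<in> S - {x}" "b \<in> S - {x}"
        have "a + b \<noteq> x"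
        proof (cases "a = 0 \<or> b = 0")
          case True then show ?thesis using ab by auto
        next
          case False then show ?thesis using ab x unfolding I_def by blast
        qed
        then show "a + b \<in> S - {x}" using ab S by (auto simp: submonoid_vec_def)
      qed
      ultimately have "S \<subseteq> S - {x}" using generated_minimal A by metis
      then show False using x by (auto simp: I_def)
    qed
  qed
  have pos: "0 < (\<Sum>i\<in>UNIV. x $ i)" if "x \<noteq> 0" for x :: "nat ^ 'p"
  proof -
    from that obtain i where "x $ i \<noteq> 0" unfolding vec_eq_iff by auto
    then show ?thesis by (intro sum_pos2[of UNIV i]) auto
  qed
  have "x \<in> generated I" if "x \<in> S" for x
    using that
  proof (induction "\<Sum>i\<in>UNIV. x $ i" arbitrary: x rule: less_induct)
    case less
    show ?case
    proof (cases "x \<in> I \<or> x = 0")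
      case True
      then show ?thesis using subset_generated[of I] submonoid_generated[of I]
        by (auto simp: submonoid_vec_def)
    next
      case False
      then obtain a b where ab: "a \<in> S" "b \<in> S" "a \<noteq> 0" "b \<noteq> 0" "x = a + b"
        using less.prems unfolding I_def by blast
      then have "a \<in> generated I" "b \<in> generated I"
        using pos[of a] pos[of b] by (auto intro!: less.hyps simp: sum.distrib)
      then show ?thesis using submonoid_generated[of I] ab by (auto simp: submonoid_vec_def)
    qed
  qed
  moreover have "generated I \<subseteq> S" by (rule generated_minimal) (auto simp: I_def S)
  ultimately have I_gen: "generated I = S" by auto
  show ?thesis
  proof (rule ex1I)
    show "minimal_generating_set S I"
      unfolding minimal_generating_set_def using I_gen I_sub by blast
    show "A = I" if "minimal_generating_set S A" for A
      using that I_gen I_sub unfolding minimal_generating_set_def by blast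
  qed
qed

end

theory Submission
  imports Defs
begin

text \<open>An affine semigroup with set of multiplicities \<open>E\<close> spans the same cone as \<open>E\<close>, because every
  extremal ray carries a multiplicity. It therefore lies between \<open>\<langle>E\<rangle>\<close> and \<open>\<C>(E)\<close>, which leaves
  finitely many choices when the gap is finite. Conversely, for every nonzero \<open>t \<in> \<langle>E\<rangle>\<close> the set
  \<open>\<langle>E\<rangle> \<union> (t + \<C>(E))\<close> is a strong affine semigroup with multiplicities \<open>E\<close>. By Gordan's lemma
  \<open>\<C>(E)\<close> is a finite union of translates \<open>u + \<langle>E\<rangle>\<close>, so if the gap is infinite, then \<open>u + t\<close> is a gap
  for some fixed \<open>u\<close> and infinitely many \<open>t\<close>. If infinitely many of these \<open>t\<close> gave the same
  semigroup, all of them would be bounded componentwise by \<open>t\<^sub>0 + u\<close> for one of them \<open>t\<^sub>0\<close>.\<close>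

section \<open>Generated submonoids and minimal generating sets\<close>

lemma obtain_min_card:
  assumes "P L"
  obtains A where "P A" "\<And>B. P B \<Longrightarrow> card A \<le> card B"
  using assms ex_has_least_nat[of P L card] by blast

lemma generated_mono: "A \<subseteq> generated B \<Longrightarrow> generated A \<subseteq> generated B"
  by (rule generated_minimal) (auto simp: submonoid_generated)

lemma generated_add: "x \<in> generated L \<Longrightarrow> y \<in> generated L \<Longrightarrow> x + y \<in> generated L"
  using submonoid_generated[of L] by (auto simp: submonoid_vec_def)

lemma zero_in_generated: "0 \<in> generated L"
  using submonoid_generated[of L] by (auto simp: submonoid_vec_def)

lemma generated_sum: "(\<And>i. i \<in> I \<Longrightarrow> f i \<in> generated L) \<Longrightarrow> sum f I \<in> generated L"
  by (induction I rule: infinite_finite_induct) (auto simp: zero_in_generated generated_add)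

lemma generated_times: "x \<in> generated L \<Longrightarrow> of_nat n * x \<in> generated L"
  by (induction n) (auto simp: zero_in_generated generated_add algebra_simps)

text \<open>The elements that are zero or split off a generator form a submonoid containing
  \<open>E\<close>, so they exhaust \<open>generated E\<close>.\<close>

lemma generated_decompose:
  assumes "x \<in> generated E" "x \<noteq> 0"
  obtains e r where "e \<in> E" "r \<in> generated E" "x = e + r"
proof -
  let ?S = "{x. x \<in> generated E \<and> (x = 0 \<or> (\<exists>e\<in>E. \<exists>r\<in>generated E. x = e + r))}"
  have "submonoid_vec ?S"
    unfolding submonoid_vec_def
  proof (intro conjI ballI)
    show "0 \<in> ?S" by (simp add: zero_in_generated)
    fix x y assume x: "x \<in> ?S" and y: "y \<in> ?S"
    show "x + y \<in> ?S"
    proof (cases "x = 0")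
      case True
      then show ?thesis using y by simp
    next
      case False
      then obtain e r where "e \<in> E" "r \<in> generated E" "x = e + r" using x by blast
      moreover from this have "r + y \<in> generated E" "x + y = e + (r + y)"
        using y by (auto simp: generated_add add.assoc)
      moreover have "x + y \<in> generated E" using x y by (blast intro: generated_add)
      ultimately show ?thesis by blast
    qed
  qed
  moreover have "E \<subseteq> ?S"
  proof
    fix e assume "e \<in> E"
    then show "e \<in> ?S"
      using subset_generated[of E] zero_in_generated[of E] add.right_neutral[of e, symmetric] by blast
  qed
  ultimately have "generated E \<subseteq> ?S"
    by (intro generated_minimal)
  with assms that show thesis by blast
qed

lemma minimal_generating_set_msg: "submonoid_vec S \<Longrightarrow> minimal_generating_set S (msg S)"
  unfolding msg_def by (rule theI') (rule minimal_generating_set_ex1)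

lemma submonoid_affine_semigroup: "affine_semigroup S \<Longrightarrow> submonoid_vec S"
  by (auto simp: affine_semigroup_def submonoid_generated)

lemma generated_msg: "affine_semigroup S \<Longrightarrow> generated (msg S) = S"
  using minimal_generating_set_msg[OF submonoid_affine_semigroup]
  by (auto simp: minimal_generating_set_def)

lemma msg_subset: "affine_semigroup S \<Longrightarrow> msg S \<subseteq> S"
  using subset_generated[of "msg S"] generated_msg by metis

text \<open>Inside a finite generating set, a generating subset of least cardinality is minimal, and
  by uniqueness it is \<open>msg S\<close>.\<close>

lemma finite_msg:
  assumes "affine_semigroup S"
  shows "finite (msg S)"
proof -
  obtain L where L: "finite L" "S = generated L"
    using assms by (auto simp: affine_semigroup_def)
  obtain A where A: "A \<subseteq> L \<and> generated A = S"
    and min: "\<And>B. B \<subseteq> L \<and> generated B = S \<Longrightarrow> card A \<le> card B"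
    using obtain_min_card[of "\<lambda>A. A \<subseteq> L \<and> generated A = S" L] L by blast
  have "finite A" using A L finite_subset by blast
  then have "minimal_generating_set S A"
    unfolding minimal_generating_set_def using A min
    by (metis leD order_trans psubset_card_mono psubset_imp_subset)
  then have "A = msg S"
    using minimal_generating_set_ex1 minimal_generating_set_msg submonoid_affine_semigroup[OF assms]
    by blast
  then show ?thesis using \<open>finite A\<close> by simp
qed

text \<open>Every submonoid contains 0 already, so a generator 0 could be dropped, against
  minimality.\<close>

lemma zero_notin_msg:
  assumes "affine_semigroup S"
  shows "0 \<notin> msg S"
proof
  assume "0 \<in> msg S"
  then have "msg S - {0} \<subset> msg S" by auto
  moreover have "generated (msg S - {0}) = S"
  proof -
    have "msg S \<subseteq> generated (msg S - {0})"
      using subset_generated[of "msg S - {0}"] zero_in_generated by blast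
    then have "generated (msg S) \<subseteq> generated (msg S - {0})" by (rule generated_mono)
    moreover have "generated (msg S - {0}) \<subseteq> generated (msg S)"
      using subset_generated by (intro generated_mono) blast
    ultimately show ?thesis using generated_msg[OF assms] by simp
  qed
  ultimately show False
    using minimal_generating_set_msg[OF submonoid_affine_semigroup[OF assms]]
    by (auto simp: minimal_generating_set_def)
qed

section \<open>Integer points of cones\<close>

lemma real_vec_add: "real_vec (x + y) = real_vec x + real_vec y"
  by (simp add: real_vec_def vec_eq_iff)

lemma real_vec_nth: "real_vec x $ i = real (x $ i)"
  by (simp add: real_vec_def)

lemma submonoid_int_cone: "submonoid_vec (int_cone L)"
  unfolding submonoid_vec_def
proof (intro conjI ballI)
  show "0 \<in> int_cone L"
    by (auto simp: int_cone_def real_vec_def vec_eq_iff intro!: exI[of _ "\<lambda>_. 0"])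
  fix x y assume "x \<in> int_cone L" "y \<in> int_cone L"
  then obtain a b where "\<forall>l\<in>L. 0 \<le> a l" "real_vec x = (\<Sum>l\<in>L. a l *\<^sub>R real_vec l)"
    "\<forall>l\<in>L. 0 \<le> b l" "real_vec y = (\<Sum>l\<in>L. b l *\<^sub>R real_vec l)"
    unfolding int_cone_def by blast
  then show "x + y \<in> int_cone L"
    unfolding int_cone_def
    by (auto simp: real_vec_add scaleR_add_left sum.distrib intro!: exI[of _ "\<lambda>l. a l + b l"])
qed

lemma int_cone_add: "x \<in> int_cone L \<Longrightarrow> y \<in> int_cone L \<Longrightarrow> x + y \<in> int_cone L"
  using submonoid_int_cone[of L] by (auto simp: submonoid_vec_def)

lemma int_cone_scaleR:
  assumes "finite L" "l \<in> L" "0 \<le> c" "real_vec x = c *\<^sub>R real_vec l"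
  shows "x \<in> int_cone L"
proof -
  have "(\<Sum>k\<in>L. (if k = l then c else 0) *\<^sub>R real_vec k) = (\<Sum>k\<in>L. if k = l then c *\<^sub>R real_vec k else 0)"
    by (intro sum.cong) auto
  then show ?thesis
    using assms unfolding int_cone_def
    by (auto intro!: exI[of _ "\<lambda>k. if k = l then c else 0"])
qed

lemma subset_int_cone: "finite L \<Longrightarrow> L \<subseteq> int_cone L"
  using int_cone_scaleR[of L _ 1] by auto

lemma generated_subset_int_cone: "finite L \<Longrightarrow> generated L \<subseteq> int_cone L"
  by (simp add: generated_minimal subset_int_cone submonoid_int_cone)

text \<open>Expanding each element of \<open>A\<close> over \<open>B\<close> and exchanging the sums
  gives the coefficients over \<open>B\<close> as a matrix-vector product.\<close>

lemma int_cone_mono: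
  assumes "A \<subseteq> int_cone B"
  shows "int_cone A \<subseteq> int_cone B"
proof
  fix x assume "x \<in> int_cone A"
  then obtain a where a: "\<forall>l\<in>A. 0 \<le> a l" "real_vec x = (\<Sum>l\<in>A. a l *\<^sub>R real_vec l)"
    unfolding int_cone_def by blast
  have "\<forall>l\<in>A. \<exists>b. (\<forall>k\<in>B. 0 \<le> b k) \<and> real_vec l = (\<Sum>k\<in>B. b k *\<^sub>R real_vec k)"
    using assms unfolding int_cone_def by blast
  then obtain b where b: "\<forall>l\<in>A. (\<forall>k\<in>B. 0 \<le> b l k) \<and> real_vec l = (\<Sum>k\<in>B. b l k *\<^sub>R real_vec k)"
    by (auto simp: bchoice_iff)
  have "real_vec x = (\<Sum>l\<in>A. \<Sum>k\<in>B. (a l * b l k) *\<^sub>R real_vec k)"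
    unfolding a(2)
  proof (rule sum.cong)
    fix l assume "l \<in> A"
    then have "real_vec l = (\<Sum>k\<in>B. b l k *\<^sub>R real_vec k)" using b by blast
    then show "a l *\<^sub>R real_vec l = (\<Sum>k\<in>B. (a l * b l k) *\<^sub>R real_vec k)"
      by (simp add: scaleR_sum_right)
  qed simp
  also have "\<dots> = (\<Sum>k\<in>B. (\<Sum>l\<in>A. a l * b l k) *\<^sub>R real_vec k)"
    by (subst sum.swap) (simp add: scaleR_sum_left)
  finally show "x \<in> int_cone B"
    unfolding int_cone_def using a b
    by (auto intro!: exI[of _ "\<lambda>k. \<Sum>l\<in>A. a l * b l k"] sum_nonneg)
qed

lemma int_cone_subset_mono: "finite B \<Longrightarrow> A \<subseteq> B \<Longrightarrow> int_cone A \<subseteq> int_cone B"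
  using subset_int_cone by (intro int_cone_mono) blast

text \<open>\<open>E\<close> and \<open>msg S\<close> each lie in the cone of the other. This frees
  \<open>cone_of\<close> from the description operator in \<open>msg\<close>.\<close>

lemma cone_of_eq_int_cone:
  assumes "affine_semigroup S" "finite E" "E \<subseteq> S" "S \<subseteq> int_cone E"
  shows "cone_of S = int_cone E"
proof -
  have "E \<subseteq> int_cone (msg S)"
    using assms(3) generated_msg[OF assms(1)] generated_subset_int_cone[OF finite_msg[OF assms(1)]]
    by blast
  moreover have "msg S \<subseteq> int_cone E"
    using msg_subset assms by blast
  ultimately show ?thesis
    unfolding cone_of_def using int_cone_mono by (metis subset_antisym)
qed

lemma affine_subset_cone_of: "affine_semigroup S \<Longrightarrow> S \<subseteq> cone_of S"
  using generated_msg generated_subset_int_cone[OF finite_msg] unfolding cone_of_def by metis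

section \<open>The order \<open>le_sg\<close>, multiplicities and the cone they span\<close>

lemma le_sg_refl: "submonoid_vec T \<Longrightarrow> le_sg T x x"
  unfolding le_sg_def submonoid_vec_def by (metis add.right_neutral)

lemma le_sg_trans: "submonoid_vec T \<Longrightarrow> le_sg T x y \<Longrightarrow> le_sg T y z \<Longrightarrow> le_sg T x z"
  unfolding le_sg_def submonoid_vec_def by (metis add.assoc)

lemma le_sg_imp_nth_le: "le_sg T x y \<Longrightarrow> x $ i \<le> y $ i"
  by (auto simp: le_sg_def)

lemma le_sg_antisym: "le_sg T x y \<Longrightarrow> le_sg T y x \<Longrightarrow> x = y"
  by (simp add: vec_eq_iff le_antisym le_sg_imp_nth_le)

text \<open>Descent terminates because the coordinate sum drops strictly on passing to a different
  element below.\<close>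

lemma ex_min_sg_le:
  assumes T: "submonoid_vec T" and "x \<in> A"
  shows "\<exists>y\<in>min_sg T A. le_sg T y x"
  using assms(2)
proof (induction "\<Sum>i\<in>UNIV. x $ i" arbitrary: x rule: less_induct)
  case less
  show ?case
  proof (cases "x \<in> min_sg T A")
    case True
    then show ?thesis using le_sg_refl[OF T] by blast
  next
    case False
    then obtain y where y: "y \<in> A" "le_sg T y x" "y \<noteq> x"
      using less.prems by (auto simp: min_sg_def)
    then obtain i where "y $ i \<noteq> x $ i" by (auto simp: vec_eq_iff)
    then have "(\<Sum>i\<in>UNIV. y $ i) < (\<Sum>i\<in>UNIV. x $ i)"
      using le_sg_imp_nth_le[OF y(2)] by (intro sum_strict_mono_ex1) (auto intro!: le_neq_trans)
    then show ?thesis using less.hyps y le_sg_trans[OF T] by blast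
  qed
qed

text \<open>A minimal cone-generating subset of \<open>G\<close> consists of vectors on pairwise distinct extremal rays,
  so each of them is a multiple of its summand from \<open>E\<close>.\<close>
lemma int_cone_subset_of_summands:
  assumes G: "finite G" "0 \<notin> G" and E: "finite E" "0 \<notin> E" "E \<subseteq> int_cone G"
    and split: "\<And>g. g \<in> G \<Longrightarrow> \<exists>e\<in>E. le_sg (int_cone G) e g"
  shows "int_cone G \<subseteq> int_cone E"
proof -
  \<comment> \<open>Least cardinality will ensure that no element of \<open>H\<close> lies in the
    cone of the others.\<close>
  obtain H where H: "H \<subseteq> G \<and> int_cone H = int_cone G"
    and min: "\<And>B. B \<subseteq> G \<and> int_cone B = int_cone G \<Longrightarrow> card H \<le> card B"
    using obtain_min_card[of "\<lambda>A. A \<subseteq> G \<and> int_cone A = int_cone G" G] by blast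
  have fH: "finite H" using H G finite_subset by blast
  have "H \<subseteq> int_cone E"
  proof
    fix g assume g: "g \<in> H"
    then obtain e t where et: "e \<in> E" "t \<in> int_cone H" "g = e + t"
      using split[of g] H unfolding le_sg_def by auto
    have "e \<in> int_cone H" using E H et by blast
    then obtain a where a: "\<forall>l\<in>H. 0 \<le> a l" "real_vec e = (\<Sum>l\<in>H. a l *\<^sub>R real_vec l)"
      unfolding int_cone_def by blast
    from et obtain b where b: "\<forall>l\<in>H. 0 \<le> b l" "real_vec t = (\<Sum>l\<in>H. b l *\<^sub>R real_vec l)"
      unfolding int_cone_def by blast
    \<comment> \<open>Adding the expansions of \<open>e\<close> and \<open>t\<close> expresses
      \<open>g\<close> over \<open>H\<close>; \<open>?c\<close> is the coefficient of
      \<open>g\<close> itself and \<open>?r\<close> collects the other terms.\<close>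
    let ?c = "a g + b g"
    let ?r = "\<Sum>l\<in>H-{g}. (a l + b l) *\<^sub>R real_vec l"
    have "real_vec g = (\<Sum>l\<in>H. (a l + b l) *\<^sub>R real_vec l)"
      using a b et by (simp add: real_vec_add scaleR_add_left sum.distrib)
    then have gr: "real_vec g = ?c *\<^sub>R real_vec g + ?r"
      using sum.remove[OF fH g, of "\<lambda>l. (a l + b l) *\<^sub>R real_vec l"] by simp
    \<comment> \<open>Otherwise solving for \<open>g\<close> puts it in the cone of
      \<open>H - {g}\<close>, which would then be a smaller spanning set.\<close>
    have c1: "1 \<le> ?c"
    proof (rule ccontr)
      assume "\<not> 1 \<le> ?c"
      then have pos: "0 < 1 - ?c" by simp
      have "(1 - ?c) *\<^sub>R real_vec g = ?r"
        using gr by (simp add: algebra_simps)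
      then have "inverse (1 - ?c) *\<^sub>R ((1 - ?c) *\<^sub>R real_vec g) = inverse (1 - ?c) *\<^sub>R ?r"
        by (rule arg_cong)
      then have "real_vec g = inverse (1 - ?c) *\<^sub>R ?r"
        using pos by simp
      then have "real_vec g = (\<Sum>l\<in>H-{g}. (inverse (1 - ?c) * (a l + b l)) *\<^sub>R real_vec l)"
        by (simp add: scaleR_sum_right)
      then have "g \<in> int_cone (H - {g})"
        unfolding int_cone_def using pos a b
        by (auto intro!: exI[of _ "\<lambda>l. inverse (1 - ?c) * (a l + b l)"])
      then have "H \<subseteq> int_cone (H - {g})"
        using subset_int_cone[of "H - {g}"] fH by blast
      then have "int_cone H \<subseteq> int_cone (H - {g})" by (rule int_cone_mono)
      moreover have "int_cone (H - {g}) \<subseteq> int_cone H"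
        using fH by (intro int_cone_subset_mono) auto
      ultimately have "card H \<le> card (H - {g})" using H min[of "H - {g}"] by blast
      then show False using fH g by (metis card_Diff1_less leD)
    qed
    \<comment> \<open>With \<open>?c\<close> at least 1, the nonnegative terms of \<open>?r\<close>
      cannot be positive in any coordinate. A coordinate where \<open>l\<close> is nonzero therefore
      forces \<open>a l + b l\<close> to vanish.\<close>
    have a0: "a l = 0" if l: "l \<in> H - {g}" for l
    proof -
      have "l \<noteq> 0" using l H G by blast
      then obtain i where i: "l $ i \<noteq> 0" by (auto simp: vec_eq_iff)
      have "real (g $ i) = ?c * real (g $ i) + (\<Sum>l\<in>H-{g}. (a l + b l) * real (l $ i))"
        using arg_cong[OF gr, of "\<lambda>v. v $ i"] by (simp add: real_vec_nth)
      moreover have "1 * real (g $ i) \<le> ?c * real (g $ i)"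
        using c1 by (intro mult_right_mono) auto
      moreover have "(a l + b l) * real (l $ i) \<le> (\<Sum>l\<in>H-{g}. (a l + b l) * real (l $ i))"
        using l a b fH by (intro member_le_sum) auto
      ultimately have "(a l + b l) * real (l $ i) \<le> 0" by linarith
      then have "a l + b l \<le> 0" using i by (simp add: mult_le_0_iff)
      then show ?thesis using a b l by (smt (verit) DiffD1)
    qed
    have "real_vec e = a g *\<^sub>R real_vec g"
      using a(2) sum.remove[OF fH g, of "\<lambda>l. a l *\<^sub>R real_vec l"] a0 by simp
    \<comment> \<open>Now \<open>e\<close> is a multiple of \<open>g\<close>. Since \<open>e\<close>
      is nonzero the factor can be inverted, so \<open>g\<close> lies on the ray of
      \<open>e\<close>.\<close>
    moreover have "a g \<noteq> 0"
    proof
      assume "a g = 0"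
      with calculation have "real_vec e = 0" by simp
      then have "e = 0" by (simp add: vec_eq_iff real_vec_nth)
      then show False using et E by blast
    qed
    ultimately have "real_vec g = inverse (a g) *\<^sub>R real_vec e" by simp
    then show "g \<in> int_cone E"
      using int_cone_scaleR[OF E(1) et(1), of "inverse (a g)"] a(1) g by simp
  qed
  then show ?thesis using H int_cone_mono by blast
qed

text \<open>Multiplicities are minimal for the order of the cone of \<open>msg S\<close>, so each
  minimal generator has one below it. This is the splitting hypothesis of
  \<open>int_cone_subset_of_summands\<close> for \<open>msg S\<close>.\<close>

lemma cone_of_eq_int_cone_Mult:
  assumes "affine_semigroup S" "finite (Mult S)"
  shows "cone_of S = int_cone (Mult S)"
proof -
  have M: "Mult S \<subseteq> S - {0}" by (auto simp: Mult_def min_sg_def)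
  have "\<exists>e\<in>Mult S. le_sg (int_cone (msg S)) e g" if "g \<in> msg S" for g
    using that zero_notin_msg[OF assms(1)] msg_subset[OF assms(1)] submonoid_int_cone
    unfolding Mult_def cone_of_def by (intro ex_min_sg_le) auto
  then have "cone_of S \<subseteq> int_cone (Mult S)"
    unfolding cone_of_def using assms M affine_subset_cone_of[OF assms(1)]
    by (intro int_cone_subset_of_summands finite_msg zero_notin_msg) (auto simp: cone_of_def)
  moreover have "int_cone (Mult S) \<subseteq> cone_of S"
    unfolding cone_of_def using M affine_subset_cone_of[OF assms(1)]
    by (intro int_cone_mono) (auto simp: cone_of_def)
  ultimately show ?thesis by blast
qed

text \<open>By \<open>dom\<close> a minimal element must belong to \<open>E\<close>. Conversely,
  anything below \<open>e\<close> in \<open>E\<close> has some \<open>e'\<close> of \<open>E\<close>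
  below it; incomparability gives \<open>e' = e\<close>, and antisymmetry closes the gap.\<close>

lemma Mult_eqI:
  assumes inc: "incomparable E" and S: "affine_semigroup S" "E \<subseteq> S" "S \<subseteq> int_cone E"
    and dom: "\<And>x. x \<in> S \<Longrightarrow> x \<noteq> 0 \<Longrightarrow> \<exists>e\<in>E. le_sg (int_cone E) e x"
  shows "Mult S = E"
proof -
  have E: "finite E" "0 \<notin> E" "E = min_sg (int_cone E) E"
    using inc by (auto simp: incomparable_def)
  have "Mult S = min_sg (int_cone E) (S - {0})"
    unfolding Mult_def using cone_of_eq_int_cone[OF S(1) E(1) S(2,3)] by simp
  also have "\<dots> = E"
  proof (intro equalityI subsetI)
    fix x assume "x \<in> min_sg (int_cone E) (S - {0})"
    then show "x \<in> E" using dom[of x] S(2) E(2) unfolding min_sg_def by blast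
  next
    fix e assume e: "e \<in> E"
    have "y = e" if y: "y \<in> S - {0}" "le_sg (int_cone E) y e" for y
    proof -
      obtain e' where e': "e' \<in> E" "le_sg (int_cone E) e' y" using y dom by auto
      then have "le_sg (int_cone E) e' e" using y le_sg_trans submonoid_int_cone by blast
      then have "e' = e" using E(3) e e' unfolding min_sg_def by blast
      then show ?thesis using e' y le_sg_antisym by blast
    qed
    then show "e \<in> min_sg (int_cone E) (S - {0})"
      using e S(2) E(2) unfolding min_sg_def by blast
  qed
  finally show ?thesis .
qed

section \<open>The cone as a finite union of translates of \<open>generated E\<close>\<close>

lemma finite_vec_bounded: "finite {x :: nat ^ 'n. \<forall>i. x $ i \<le> b $ i}"
proof -
  have "{x :: nat ^ 'n. \<forall>i. x $ i \<le> b $ i} \<subseteq> vec_lambda ` (PiE UNIV (\<lambda>i. {..b $ i}))"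
  proof
    fix x :: "nat ^ 'n" assume "x \<in> {x. \<forall>i. x $ i \<le> b $ i}"
    then have "x = vec_lambda (vec_nth x)" "vec_nth x \<in> PiE UNIV (\<lambda>i. {..b $ i})"
      by auto
    then show "x \<in> vec_lambda ` (PiE UNIV (\<lambda>i. {..b $ i}))" by blast
  qed
  then show ?thesis by (rule finite_subset) (auto intro!: finite_imageI finite_PiE)
qed

text \<open>Gordan's lemma: subtract the integer parts of the coefficients.\<close>
lemma int_cone_finite_module:
  assumes "finite E"
  obtains U where "finite U" "U \<subseteq> int_cone E"
    "\<And>x. x \<in> int_cone E \<Longrightarrow> \<exists>u\<in>U. \<exists>r\<in>generated E. x = u + r"
proof
  \<comment> \<open>The remainders have coefficients in [0, 1), so they fall in the box below the
    sum of \<open>E\<close>, which has finitely many integer points.\<close>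
  define U where "U = int_cone E \<inter> {x. \<forall>i. x $ i \<le> (\<Sum>e\<in>E. e) $ i}"
  show "finite U" unfolding U_def using finite_vec_bounded by blast
  show "U \<subseteq> int_cone E" by (auto simp: U_def)
  fix x assume "x \<in> int_cone E"
  then obtain a where a: "\<forall>l\<in>E. 0 \<le> a l" "real_vec x = (\<Sum>l\<in>E. a l *\<^sub>R real_vec l)"
    unfolding int_cone_def by blast
  define r where "r = (\<Sum>l\<in>E. of_nat (nat \<lfloor>a l\<rfloor>) * l)"
  \<comment> \<open>This subtraction truncates on nat; the fact \<open>le\<close> below shows that
    it is exact here.\<close>
  define u where "u = (\<chi> i. x $ i - r $ i)"
  \<comment> \<open>Multiplication of vectors is componentwise and \<open>of_nat n\<close> is the
    constant vector, so the product is the scalar multiple.\<close>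
  have nth: "of_nat n * v = (\<chi> i. n * v $ i)" for n and v :: "nat ^ 'a"
    by (induction n) (auto simp: vec_eq_iff algebra_simps)
  have xi: "real (x $ i) = (\<Sum>l\<in>E. a l * real (l $ i))" for i
    using arg_cong[OF a(2), of "\<lambda>v. v $ i"] by (simp add: real_vec_nth)
  have ri: "real (r $ i) = (\<Sum>l\<in>E. of_int \<lfloor>a l\<rfloor> * real (l $ i))" for i
    unfolding r_def using a(1) by (auto simp: nth intro!: sum.cong)
  have diff: "real (x $ i) - real (r $ i) = (\<Sum>l\<in>E. frac (a l) * real (l $ i))" for i
    by (simp add: xi ri frac_def sum_subtractf[symmetric] algebra_simps)
  have "0 \<le> real (x $ i) - real (r $ i)" for i
    unfolding diff by (intro sum_nonneg) auto
  then have le: "r $ i \<le> x $ i" for i by (simp add: le_diff_eq)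
  then have x: "x = u + r" by (simp add: u_def vec_eq_iff)
  have ui: "real (u $ i) = (\<Sum>l\<in>E. frac (a l) * real (l $ i))" for i
    using diff[of i] le[of i] by (simp add: u_def of_nat_diff)
  have "u \<in> int_cone E"
    unfolding int_cone_def
    by (auto simp: vec_eq_iff real_vec_nth ui intro!: exI[of _ "\<lambda>l. frac (a l)"])
  moreover have "u $ i \<le> (\<Sum>e\<in>E. e) $ i" for i
  proof -
    have "real (u $ i) \<le> (\<Sum>l\<in>E. 1 * real (l $ i))"
      unfolding ui by (intro sum_mono mult_right_mono) (auto intro: less_imp_le frac_lt_1)
    also have "\<dots> = real ((\<Sum>e\<in>E. e) $ i)" by simp
    finally show ?thesis by (simp only: of_nat_le_iff)
  qed
  moreover have "r \<in> generated E"
    unfolding r_def using subset_generated[of E] by (auto intro!: generated_sum generated_times)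
  ultimately show "\<exists>u\<in>U. \<exists>r\<in>generated E. x = u + r"
    using x by (auto simp: U_def)
qed

section \<open>Strong semigroups with prescribed multiplicities\<close>

text \<open>All gaps of \<open>generated E\<close> above \<open>t\<close> are filled. For
  \<open>t\<close> in \<open>generated E\<close> the translate is an ideal of the cone, so the union
  is closed under addition.\<close>

definition extended_semigroup :: "(nat ^ 'p) set \<Rightarrow> nat ^ 'p \<Rightarrow> (nat ^ 'p) set" where
  "extended_semigroup E t = generated E \<union> (+) t ` int_cone E"

text \<open>For finite generation, write a cone element as \<open>u + r\<close> with
  \<open>u\<close> in the finite set \<open>U\<close>: then \<open>t + c = (t + u) + r\<close>, so
  \<open>E\<close> and the translate of \<open>U\<close> by \<open>t\<close> generate.\<close>

lemma affine_extended_semigroup: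
  assumes E: "finite E" and t: "t \<in> generated E"
  shows "affine_semigroup (extended_semigroup E t)"
proof -
  note TC = generated_subset_int_cone[OF E]
  obtain U where U: "finite U" "U \<subseteq> int_cone E"
    and dec: "\<And>x. x \<in> int_cone E \<Longrightarrow> \<exists>u\<in>U. \<exists>r\<in>generated E. x = u + r"
    using int_cone_finite_module[OF E] by blast
  let ?L = "E \<union> (+) t ` U"
  have "submonoid_vec (extended_semigroup E t)"
    unfolding submonoid_vec_def
  proof (intro conjI ballI)
    show "0 \<in> extended_semigroup E t" by (simp add: extended_semigroup_def zero_in_generated)
    have shift: "t + c \<in> extended_semigroup E t" if "c \<in> int_cone E" for c
      using that by (simp add: extended_semigroup_def)
    fix x y assume "x \<in> extended_semigroup E t" "y \<in> extended_semigroup E t"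
    then consider "x \<in> generated E" "y \<in> generated E"
      | c where "x \<in> int_cone E" "y = t + c" "c \<in> int_cone E"
      | c where "y \<in> int_cone E" "x = t + c" "c \<in> int_cone E"
      | c d where "x = t + c" "c \<in> int_cone E" "y = t + d" "d \<in> int_cone E"
      using TC unfolding extended_semigroup_def by blast
    then show "x + y \<in> extended_semigroup E t"
    proof cases
      case 1
      then show ?thesis by (simp add: extended_semigroup_def generated_add)
    next
      case (2 c)
      then show ?thesis using shift[of "x + c"] int_cone_add[of x E c] by (simp add: add_ac)
    next
      case (3 c)
      then show ?thesis using shift[of "y + c"] int_cone_add[of y E c] by (simp add: add_ac)
    next
      \<comment> \<open>One copy of \<open>t\<close> stays as the base point and the other is
        absorbed into the cone.\<close>
      case (4 c d)
      moreover have "t + c + d \<in> int_cone E" using 4 TC t int_cone_add by blast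
      ultimately show ?thesis using shift[of "t + c + d"] by (simp add: add_ac)
    qed
  qed
  moreover have "?L \<subseteq> extended_semigroup E t"
    using U subset_generated[of E] by (auto simp: extended_semigroup_def)
  ultimately have "generated ?L \<subseteq> extended_semigroup E t" by (intro generated_minimal)
  moreover have "extended_semigroup E t \<subseteq> generated ?L"
  proof -
    have sub: "E \<subseteq> generated ?L" "(+) t ` U \<subseteq> generated ?L"
      using subset_generated[of ?L] by auto
    then have T: "generated E \<subseteq> generated ?L" using generated_mono by blast
    have "t + c \<in> generated ?L" if "c \<in> int_cone E" for c
    proof -
      obtain u r where "u \<in> U" "r \<in> generated E" "c = u + r" using dec \<open>c \<in> int_cone E\<close> by blast
      then show ?thesis using generated_add[of "t + u" ?L r] sub T by (auto simp: add.assoc)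
    qed
    then show ?thesis using T by (auto simp: extended_semigroup_def)
  qed
  ultimately show ?thesis
    unfolding affine_semigroup_def using U E by (intro exI[of _ ?L]) auto
qed

text \<open>A new element lies above \<open>t\<close>, and the nonzero \<open>t\<close> lies above
  one of its generators.\<close>

lemma extended_semigroup_summand:
  assumes E: "finite E" and t: "t \<in> generated E" "t \<noteq> 0"
    and x: "x \<in> extended_semigroup E t" "x \<noteq> 0"
  shows "\<exists>e\<in>E. le_sg (int_cone E) e x"
proof -
  note TC = generated_subset_int_cone[OF E]
  have gen: "\<exists>e\<in>E. le_sg (int_cone E) e y" if "y \<in> generated E" "y \<noteq> 0" for y
  proof -
    obtain e r where "e \<in> E" "r \<in> generated E" "y = e + r"
      using generated_decompose[of y E] \<open>y \<in> generated E\<close> \<open>y \<noteq> 0\<close> by blast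
    then show ?thesis using TC unfolding le_sg_def by blast
  qed
  show ?thesis
  proof (cases "x \<in> generated E")
    case True
    then show ?thesis using gen x by blast
  next
    case False
    then obtain c where "c \<in> int_cone E" "x = t + c" using x by (auto simp: extended_semigroup_def)
    then have "le_sg (int_cone E) t x" by (auto simp: le_sg_def)
    then show ?thesis using gen[OF t] le_sg_trans[OF submonoid_int_cone] by blast
  qed
qed

lemma Mult_extended_semigroup:
  assumes inc: "incomparable E" and t: "t \<in> generated E" "t \<noteq> 0"
  shows "Mult (extended_semigroup E t) = E"
proof (rule Mult_eqI[OF inc])
  have E: "finite E" using inc by (simp add: incomparable_def)
  note TC = generated_subset_int_cone[OF E]
  show "affine_semigroup (extended_semigroup E t)"
    using affine_extended_semigroup E t by blast
  show "E \<subseteq> extended_semigroup E t"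
    using subset_generated by (auto simp: extended_semigroup_def)
  show "extended_semigroup E t \<subseteq> int_cone E"
    using TC t by (auto simp: extended_semigroup_def intro: int_cone_add)
qed (use inc t extended_semigroup_summand in \<open>auto simp: incomparable_def\<close>)

lemma strong_extended_semigroup:
  assumes inc: "incomparable E" and t: "t \<in> generated E" "t \<noteq> 0"
  shows "strong (extended_semigroup E t)"
proof -
  have E: "finite E" using inc by (simp add: incomparable_def)
  note TC = generated_subset_int_cone[OF E]
  let ?S = "extended_semigroup E t"
  have aff: "affine_semigroup ?S" using affine_extended_semigroup E t by blast
  have S_add: "a + b \<in> ?S" if "a \<in> ?S" "b \<in> ?S" for a b
    using submonoid_affine_semigroup[OF aff] that by (auto simp: submonoid_vec_def)
  \<comment> \<open>It suffices that one summand is a nonzero element of \<open>generated E\<close>: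
    a generator is split off there and the rest stays in \<open>?S\<close>.\<close>
  have *: "\<exists>e\<in>E. \<exists>s\<in>?S. x + y = e + s" if "x \<in> generated E" "x \<noteq> 0" "y \<in> ?S" for x y
  proof -
    obtain e r where er: "e \<in> E" "r \<in> generated E" "x = e + r"
      using generated_decompose[of x E] \<open>x \<in> generated E\<close> \<open>x \<noteq> 0\<close> by blast
    then have "r + y \<in> ?S" using S_add that by (auto simp: extended_semigroup_def)
    then show ?thesis using er by (metis add.assoc)
  qed
  have "\<exists>e\<in>E. \<exists>s\<in>?S. x + y = e + s" if x: "x \<in> ?S - {0}" and y: "y \<in> ?S - {0}" for x y
  proof -
    consider "x \<in> generated E" | "y \<in> generated E"
      | c d where "x = t + c" "c \<in> int_cone E" "y = t + d" "d \<in> int_cone E"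
      using x y unfolding extended_semigroup_def by blast
    then show ?thesis
    proof cases
      case 1
      then show ?thesis using * x y by blast
    next
      case 2
      then show ?thesis using *[of y x] x y by (auto simp: add.commute)
    next
      \<comment> \<open>In the sum \<open>t + (t + (c + d))\<close> the first \<open>t\<close>
        serves as the element of \<open>generated E\<close> from which a generator is split
        off.\<close>
      case (3 c d)
      then have "t + (c + d) \<in> ?S" by (simp add: extended_semigroup_def int_cone_add)
      then have "\<exists>e\<in>E. \<exists>s\<in>?S. t + (t + (c + d)) = e + s" using * t by blast
      then show ?thesis using 3 by (simp add: add_ac)
    qed
  qed
  then show ?thesis
    unfolding strong_def using aff Mult_extended_semigroup[OF assms] by auto
qed

lemma infinite_strong_semigroups:
  assumes inc: "incomparable E" and inf: "infinite (int_cone E - generated E)"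
  shows "infinite {S. strong S \<and> Mult S = E}"
proof
  assume fin: "finite {S. strong S \<and> Mult S = E}"
  have E: "finite E" using inc by (simp add: incomparable_def)
  obtain U where U: "finite U" "U \<subseteq> int_cone E"
    and dec: "\<And>x. x \<in> int_cone E \<Longrightarrow> \<exists>u\<in>U. \<exists>r\<in>generated E. x = u + r"
    using int_cone_finite_module[OF E] by blast
  \<comment> \<open>The shifts that turn \<open>u\<close> into a gap; 0 is excluded because the
    extended semigroup needs a nonzero base point.\<close>
  define A where "A u = {t \<in> generated E - {0}. u + t \<notin> generated E}" for u
  \<comment> \<open>A gap \<open>u + r\<close> with \<open>r = 0\<close> is \<open>u\<close> itself,
    hence the extra finite set \<open>U\<close>.\<close>
  have "int_cone E - generated E \<subseteq> U \<union> (\<Union>u\<in>U. (+) u ` A u)"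
  proof
    fix x assume x: "x \<in> int_cone E - generated E"
    then obtain u r where ur: "u \<in> U" "r \<in> generated E" "x = u + r" using dec by blast
    then show "x \<in> U \<union> (\<Union>u\<in>U. (+) u ` A u)"
      using x by (cases "r = 0") (auto simp: A_def)
  qed
  then have "infinite (U \<union> (\<Union>u\<in>U. (+) u ` A u))" using inf finite_subset by blast
  then obtain u where u: "u \<in> U" "infinite (A u)" using U(1) by auto
  have "extended_semigroup E ` A u \<subseteq> {S. strong S \<and> Mult S = E}"
    using strong_extended_semigroup[OF inc] Mult_extended_semigroup[OF inc] by (auto simp: A_def)
  then have "finite (extended_semigroup E ` A u)" using fin finite_subset by blast
  then obtain t0 where t0: "t0 \<in> A u"
    and inft: "infinite {t \<in> A u. extended_semigroup E t = extended_semigroup E t0}"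
    using pigeonhole_infinite[OF u(2)] by blast
  have "{t \<in> A u. extended_semigroup E t = extended_semigroup E t0} \<subseteq> {t. \<forall>i. t $ i \<le> (t0 + u) $ i}"
  proof safe
    fix t i assume "t \<in> A u" "extended_semigroup E t = extended_semigroup E t0"
    \<comment> \<open>The gap \<open>t0 + u\<close> is filled for \<open>t0\<close>, hence also for
      \<open>t\<close>, so it must come from the translate by \<open>t\<close>. This bounds
      \<open>t\<close>.\<close>
    moreover have "t0 + u \<in> extended_semigroup E t0" "t0 + u \<notin> generated E"
      using u U t0 by (auto simp: extended_semigroup_def A_def add.commute)
    ultimately obtain c where "t0 + u = t + c" by (auto simp: extended_semigroup_def)
    then show "t $ i \<le> (t0 + u) $ i" by simp
  qed
  then show False using inft finite_vec_bounded finite_subset by blast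
qed

theorem theorem16:
  fixes E :: "(nat ^ 'p) set"
  assumes "incomparable E"
  shows "(C_semigroup (generated E) \<longleftrightarrow> finite {S. affine_semigroup S \<and> Mult S = E}) \<and>
         (finite {S. affine_semigroup S \<and> Mult S = E} \<longleftrightarrow> finite {S. strong S \<and> Mult S = E})"
proof -
  have E: "finite E" using assms by (simp add: incomparable_def)
  have aff: "affine_semigroup (generated E)" using E by (auto simp: affine_semigroup_def)
  have "cone_of (generated E) = int_cone E"
    using cone_of_eq_int_cone[OF aff E] subset_generated generated_subset_int_cone[OF E] by blast
  then have C: "C_semigroup (generated E) \<longleftrightarrow> finite (int_cone E - generated E)"
    using aff by (simp add: C_semigroup_def)
  \<comment> \<open>Such an \<open>S\<close> lies between \<open>generated E\<close> and its cone,
    so it is determined by the set of gaps it fills.\<close>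
  have ab: "finite {S. affine_semigroup S \<and> Mult S = E}" if "finite (int_cone E - generated E)"
  proof (rule finite_subset)
    show "finite ((\<union>) (generated E) ` Pow (int_cone E - generated E))" using that by simp
    show "{S. affine_semigroup S \<and> Mult S = E} \<subseteq> (\<union>) (generated E) ` Pow (int_cone E - generated E)"
    proof safe
      fix S :: "(nat ^ 'p) set" assume S: "affine_semigroup S" "E = Mult S"
      have "S \<subseteq> int_cone E"
        using cone_of_eq_int_cone_Mult[OF S(1)] affine_subset_cone_of[OF S(1)] S E by simp
      moreover have "E \<subseteq> S" using S by (auto simp: Mult_def min_sg_def)
      then have "generated E \<subseteq> S" using generated_minimal submonoid_affine_semigroup S by blast
      ultimately have "S = generated E \<union> (S - generated E)"
        "S - generated E \<in> Pow (int_cone E - generated E)" by auto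
      then show "S \<in> (\<union>) (generated (Mult S)) ` Pow (int_cone (Mult S) - generated (Mult S))"
        using S(2) by blast
    qed
  qed
  have bc: "finite {S. strong S \<and> Mult S = E}" if "finite {S. affine_semigroup S \<and> Mult S = E}"
    by (rule finite_subset[OF _ that]) (auto simp: strong_def)
  \<comment> \<open>The cycle closes by contraposition: infinitely many gaps yield infinitely many
    strong semigroups.\<close>
  show ?thesis
    using C ab bc infinite_strong_semigroups[OF assms] by blast
qed

end
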